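(* Let $D,d,\eta,\alpha>0$ be fixed, and for $\rho>0$ let the secrecy rate $R_s$ be as in the context, with ergodic secrecy capacity $R(\rho)=\mathbb{E}(R_s)$. Then the high-SNR slope of Bob, $$\mathcal{S}=\lim_{\rho\to\infty}\frac{R(\rho)}{\log_2(\rho)},$$ exists and equals $0$.
   Context: System model. Let $x_1,y_1,x_2,y_2$ be independent random variables, each uniform on $[-\frac D2,\frac D2]$. The legitimate user (Bob) is at $\psi_b=[x_1,y_1,0]$, the eavesdropper (Willie) is at $\psi_w=[x_2,y_2,0]$, and the pinching antenna is at $\psi_1^{Pin}=[x_1,0,d]$ on a waveguide at height $d$ parallel to the $x$-axis. The waveguide feed point $\psi_0$ is a fixed point $[x_0,0,d]$ with $x_0\in[-\frac D2,\frac D2]$, so that $0\le|\psi_0-\psi_1^{Pin}|\le D$. Put $Z_b=|\psi_1^{Pin}-\psi_b|^2=y_1^2+d^2$ and $Z_w=|\psi_1^{Pin}-\psi_w|^2=(x_1-x_2)^2+y_2^2+d^2$ (Euclidean norm). Here $\eta>0$ is a constant, $\alpha$ is the waveguide attenuation constant, and $\rho>0$ is the transmit signal-to-noise ratio (transmit power divided by the noise variance, which is the same for Bob and Willie). The rates are $$R_b=\tfrac12\log_2\!\left(1+\frac{\eta\rho e^{-2\alpha|\psi_0-\psi_1^{Pin}|}}{Z_b}\right),\quad R_w=\tfrac12\log_2\!\left(1+\frac{\eta\rho e^{-2\alpha|\psi_0-\psi_1^{Pin}|}}{Z_w}\right),\quad R_s=R_b-R_w$$ (no positive part is taken in $R_s$).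 *)

theory Defs
  imports "HOL-Probability.Probability"
begin

definition ground_point :: "real \<Rightarrow> real \<Rightarrow> real ^ 3" where
  "ground_point x y = vector [x, y, 0]"

definition waveguide_point :: "real \<Rightarrow> real \<Rightarrow> real ^ 3" where
  "waveguide_point d x = vector [x, 0, d]"

definition rate :: "real \<Rightarrow> real \<Rightarrow> real \<Rightarrow> real ^ 3 \<Rightarrow> real ^ 3 \<Rightarrow> real ^ 3 \<Rightarrow> real" where
  "rate \<eta> \<alpha> \<rho> feed pin user =
     1 / 2 * log 2 (1 + \<eta> * \<rho> * exp (- 2 * \<alpha> * norm (feed - pin)) / (norm (pin - user))\<^sup>2)"

text \<open>The antenna is placed at Bob's abscissa \<open>x\<^sub>1\<close>; no positive part is taken.\<close>

definition secrecy_rate ::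
    "real \<Rightarrow> real \<Rightarrow> real \<Rightarrow> real \<Rightarrow> real \<Rightarrow> real \<Rightarrow> real \<Rightarrow> real \<Rightarrow> real \<Rightarrow> real" where
  "secrecy_rate d \<eta> \<alpha> x\<^sub>0 \<rho> x\<^sub>1 y\<^sub>1 x\<^sub>2 y\<^sub>2 =
     rate \<eta> \<alpha> \<rho> (waveguide_point d x\<^sub>0) (waveguide_point d x\<^sub>1) (ground_point x\<^sub>1 y\<^sub>1) -
     rate \<eta> \<alpha> \<rho> (waveguide_point d x\<^sub>0) (waveguide_point d x\<^sub>1) (ground_point x\<^sub>2 y\<^sub>2)"

definition ergodic_secrecy_capacity ::
    "'a measure \<Rightarrow> real \<Rightarrow> real \<Rightarrow> real \<Rightarrow> real \<Rightarrow>
     ('a \<Rightarrow> real) \<Rightarrow> ('a \<Rightarrow> real) \<Rightarrow> ('a \<Rightarrow> real) \<Rightarrow> ('a \<Rightarrow> real) \<Rightarrow> real \<Rightarrow> real" where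
  "ergodic_secrecy_capacity M d \<eta> \<alpha> x\<^sub>0 X\<^sub>1 Y\<^sub>1 X\<^sub>2 Y\<^sub>2 \<rho> =
     prob_space.expectation M (\<lambda>\<omega>. secrecy_rate d \<eta> \<alpha> x\<^sub>0 \<rho> (X\<^sub>1 \<omega>) (Y\<^sub>1 \<omega>) (X\<^sub>2 \<omega>) (Y\<^sub>2 \<omega>))"

lemma norm_waveguide_diff:
  "norm (waveguide_point d a - waveguide_point d b) = \<bar>a - b\<bar>"
  by (simp add: waveguide_point_def norm_vec_def L2_set_def sum_3 vector_3)

lemma norm_waveguide_ground_sq:
  "(norm (waveguide_point d a - ground_point x y))\<^sup>2 = (a - x)\<^sup>2 + y\<^sup>2 + d\<^sup>2"
  by (simp add: waveguide_point_def ground_point_def norm_vec_def L2_set_def sum_3 vector_3)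

lemma rate_bounds:
  assumes "d > 0" "\<eta> > 0" "\<alpha> > 0" "\<rho> > 0"
  shows "0 \<le> rate \<eta> \<alpha> \<rho> (waveguide_point d a) (waveguide_point d b) (ground_point x y)"
    and "rate \<eta> \<alpha> \<rho> (waveguide_point d a) (waveguide_point d b) (ground_point x y)
           \<le> 1 / 2 * log 2 (1 + \<eta> * \<rho> / d\<^sup>2)"
proof -
  let ?q = "\<eta> * \<rho> * exp (- 2 * \<alpha> * \<bar>a - b\<bar>) / ((b - x)\<^sup>2 + y\<^sup>2 + d\<^sup>2)"
  have q0: "0 \<le> ?q"
    using assms by (intro divide_nonneg_nonneg mult_nonneg_nonneg) auto
  have "exp (- 2 * \<alpha> * \<bar>a - b\<bar>) \<le> 1"
    using assms by simp
  then have "\<eta> * \<rho> * exp (- 2 * \<alpha> * \<bar>a - b\<bar>) \<le> \<eta> * \<rho> * 1"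
    using assms by (intro mult_left_mono) auto
  then have q1: "?q \<le> \<eta> * \<rho> / d\<^sup>2"
    using assms by (intro frac_le) auto
  show "0 \<le> rate \<eta> \<alpha> \<rho> (waveguide_point d a) (waveguide_point d b) (ground_point x y)"
    using q0 by (simp add: rate_def norm_waveguide_diff norm_waveguide_ground_sq)
  show "rate \<eta> \<alpha> \<rho> (waveguide_point d a) (waveguide_point d b) (ground_point x y)
           \<le> 1 / 2 * log 2 (1 + \<eta> * \<rho> / d\<^sup>2)"
    unfolding rate_def norm_waveguide_diff norm_waveguide_ground_sq
    using q0 q1 by (intro mult_left_mono log_mono) auto
qed

text \<open>The expectation above is a genuine one: the integrand is integrable, so the
  convention that a divergent Bochner integral is \<open>0\<close> never comes into play.\<close>

lemma integrable_secrecy_rate: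
  assumes "prob_space M" "d > 0" "\<eta> > 0" "\<alpha> > 0" "\<rho> > 0"
    and [measurable]: "X\<^sub>1 \<in> borel_measurable M" "Y\<^sub>1 \<in> borel_measurable M"
      "X\<^sub>2 \<in> borel_measurable M" "Y\<^sub>2 \<in> borel_measurable M"
  shows "integrable M (\<lambda>\<omega>. secrecy_rate d \<eta> \<alpha> x\<^sub>0 \<rho> (X\<^sub>1 \<omega>) (Y\<^sub>1 \<omega>) (X\<^sub>2 \<omega>) (Y\<^sub>2 \<omega>))"
proof -
  interpret prob_space M by fact
  show ?thesis
  proof (rule integrable_const_bound)
    show "AE \<omega> in M. norm (secrecy_rate d \<eta> \<alpha> x\<^sub>0 \<rho> (X\<^sub>1 \<omega>) (Y\<^sub>1 \<omega>) (X\<^sub>2 \<omega>) (Y\<^sub>2 \<omega>))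
            \<le> 1 / 2 * log 2 (1 + \<eta> * \<rho> / d\<^sup>2)"
    proof (rule AE_I2)
      fix \<omega>
      note b = rate_bounds[OF assms(2-5), of x\<^sub>0 "X\<^sub>1 \<omega>"]
      show "norm (secrecy_rate d \<eta> \<alpha> x\<^sub>0 \<rho> (X\<^sub>1 \<omega>) (Y\<^sub>1 \<omega>) (X\<^sub>2 \<omega>) (Y\<^sub>2 \<omega>))
              \<le> 1 / 2 * log 2 (1 + \<eta> * \<rho> / d\<^sup>2)"
        using b(1)[of "X\<^sub>1 \<omega>" "Y\<^sub>1 \<omega>"] b(2)[of "X\<^sub>1 \<omega>" "Y\<^sub>1 \<omega>"]
          b(1)[of "X\<^sub>2 \<omega>" "Y\<^sub>2 \<omega>"] b(2)[of "X\<^sub>2 \<omega>" "Y\<^sub>2 \<omega>"]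
        unfolding secrecy_rate_def real_norm_def by linarith
    qed
    show "(\<lambda>\<omega>. secrecy_rate d \<eta> \<alpha> x\<^sub>0 \<rho> (X\<^sub>1 \<omega>) (Y\<^sub>1 \<omega>) (X\<^sub>2 \<omega>) (Y\<^sub>2 \<omega>)) \<in> borel_measurable M"
      unfolding secrecy_rate_def rate_def norm_waveguide_diff norm_waveguide_ground_sq
      by measurable
  qed
qed

end

theory Submission
  imports Defs "HOL-Real_Asymp.Real_Asymp"
begin

text \<open>Bob and Willie receive the signal with the same attenuation factor, and both squared
  distances lie in a fixed interval \<open>[m, B]\<close> with \<open>m > 0\<close> almost surely. Hence the two
  signal-to-noise ratios differ by a factor of at most \<open>B / m\<close>, so the secrecy rate is bounded
  by \<open>\<onehalf> log\<^sub>2 (B / m)\<close> uniformly in \<open>\<rho>\<close>, while \<open>log\<^sub>2 \<rho>\<close> diverges.\<close>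

text \<open>The chain \<open>c / s \<le> c / m = (B / m) * (c / B) \<le> (B / m) * (c / t)\<close>
  compares the two ratios. The bound does not involve \<open>c\<close>, the only place where \<rho>
  will enter.\<close>

lemma abs_log_one_plus_divide_diff_le:
  fixes b c m u v B :: real
  assumes "1 < b" "0 \<le> c" "0 < m" "u \<in> {m..B}" "v \<in> {m..B}"
  shows "\<bar>log b (1 + c / u) - log b (1 + c / v)\<bar> \<le> log b (B / m)"
proof -
  \<comment> \<open>One-sided and for arbitrary \<open>s\<close>, \<open>t\<close> in the interval:
    using it in both orders gives the absolute value.\<close>
  have le: "log b (1 + c / s) \<le> log b (B / m) + log b (1 + c / t)"
    if s: "s \<in> {m..B}" and t: "t \<in> {m..B}" for s t
  proof -
    have pos: "0 < B" "0 < s" "0 < t"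
      using s t \<open>0 < m\<close> by auto
    have "c / s \<le> c / m"
      using s \<open>0 < m\<close> \<open>0 \<le> c\<close> by (intro divide_left_mono) auto
    also have "c / m = B / m * (c / B)"
      using pos by simp
    also have "\<dots> \<le> B / m * (c / t)"
      using pos t \<open>0 < m\<close> \<open>0 \<le> c\<close> by (intro mult_left_mono divide_left_mono) auto
    finally have "c / s \<le> B / m * (c / t)" .
    \<comment> \<open>This lets the factor \<open>B / m\<close> absorb the summand 1 as
      well.\<close>
    moreover have "1 \<le> B / m"
      using s \<open>0 < m\<close> by simp
    ultimately have "1 + c / s \<le> B / m * (1 + c / t)"
      unfolding distrib_left by simp
    moreover have "0 < 1 + c / s" "0 < 1 + c / t"
      using pos \<open>0 \<le> c\<close> by (auto intro: add_pos_nonneg)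
    ultimately have "log b (1 + c / s) \<le> log b (B / m * (1 + c / t))"
      using \<open>1 < b\<close> by (intro log_mono)
    also have "\<dots> = log b (B / m) + log b (1 + c / t)"
      using pos \<open>0 < m\<close> \<open>0 < 1 + c / t\<close> by (intro log_mult_pos) auto
    finally show ?thesis .
  qed
  show ?thesis
    using le[OF assms(4,5)] le[OF assms(5,4)] by linarith
qed

text \<open>The exponential depends on feed and antenna only, so it belongs to the common numerator
  \<open>c\<close>. The interval for the squared distances is \<open>m = d^2\<close> (the height
  alone) and \<open>B = D^2 + (D/2)^2 + d^2\<close> (largest horizontal offsets).\<close>

lemma abs_secrecy_rate_le:
  assumes "d > 0" "\<eta> > 0" "\<rho> > 0"
    and "x\<^sub>1 \<in> {- D / 2 .. D / 2}" "y\<^sub>1 \<in> {- D / 2 .. D / 2}"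
      "x\<^sub>2 \<in> {- D / 2 .. D / 2}" "y\<^sub>2 \<in> {- D / 2 .. D / 2}"
  shows "\<bar>secrecy_rate d \<eta> \<alpha> x\<^sub>0 \<rho> x\<^sub>1 y\<^sub>1 x\<^sub>2 y\<^sub>2\<bar>
           \<le> 1 / 2 * log 2 ((D\<^sup>2 + (D / 2)\<^sup>2 + d\<^sup>2) / d\<^sup>2)"
proof -
  let ?c = "\<eta> * \<rho> * exp (- 2 * \<alpha> * \<bar>x\<^sub>0 - x\<^sub>1\<bar>)"
  \<comment> \<open>The vanishing square is kept so that \<open>?u\<close> matches the rewritten
    norm literally.\<close>
  let ?u = "(x\<^sub>1 - x\<^sub>1)\<^sup>2 + y\<^sub>1\<^sup>2 + d\<^sup>2"
  let ?v = "(x\<^sub>1 - x\<^sub>2)\<^sup>2 + y\<^sub>2\<^sup>2 + d\<^sup>2"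
  let ?B = "D\<^sup>2 + (D / 2)\<^sup>2 + d\<^sup>2"
  have "\<bar>y\<^sub>1\<bar> \<le> \<bar>D / 2\<bar>" "\<bar>y\<^sub>2\<bar> \<le> \<bar>D / 2\<bar>" "\<bar>x\<^sub>1 - x\<^sub>2\<bar> \<le> \<bar>D\<bar>"
    using assms by auto
  then have "y\<^sub>1\<^sup>2 \<le> (D / 2)\<^sup>2" "y\<^sub>2\<^sup>2 \<le> (D / 2)\<^sup>2" "(x\<^sub>1 - x\<^sub>2)\<^sup>2 \<le> D\<^sup>2"
    by (simp_all only: abs_le_square_iff)
  moreover have "0 \<le> y\<^sub>1\<^sup>2" "0 \<le> y\<^sub>2\<^sup>2" "0 \<le> (x\<^sub>1 - x\<^sub>2)\<^sup>2" "0 \<le> D\<^sup>2" "(x\<^sub>1 - x\<^sub>1)\<^sup>2 = 0"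
    by simp_all
  ultimately have "?u \<in> {d\<^sup>2..?B}" "?v \<in> {d\<^sup>2..?B}"
    unfolding atLeastAtMost_iff by linarith+
  then have "\<bar>log 2 (1 + ?c / ?u) - log 2 (1 + ?c / ?v)\<bar> \<le> log 2 (?B / d\<^sup>2)"
    using assms by (intro abs_log_one_plus_divide_diff_le) auto
  then show ?thesis
    unfolding secrecy_rate_def rate_def norm_waveguide_diff norm_waveguide_ground_sq
    by linarith
qed

text \<open>The uniform measure is concentrated on \<open>A\<close>; this is pulled back along
  \<open>X\<close>.\<close>

lemma AE_in_uniform_distr:
  assumes X: "X \<in> M \<rightarrow>\<^sub>M N" and A: "A \<in> sets N"
    and distr: "distr M N X = uniform_measure N A"
  shows "AE \<omega> in M. X \<omega> \<in> A"
proof -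
  have "AE x in distr M N X. x \<in> A"
    unfolding distr using A by (intro AE_uniform_measureI) auto
  then show ?thesis
    using X by (rule AE_distrD[rotated])
qed

theorem corollary3:
  fixes M :: "'a measure"
    and X\<^sub>1 Y\<^sub>1 X\<^sub>2 Y\<^sub>2 :: "'a \<Rightarrow> real"
    and D d \<eta> \<alpha> x\<^sub>0 :: real
  assumes "prob_space M"
    and "D > 0" and "d > 0" and "\<eta> > 0" and "\<alpha> > 0"
    and "x\<^sub>0 \<in> {- D / 2 .. D / 2}"
    and "prob_space.indep_vars M (\<lambda>_. borel) (\<lambda>i::nat. [X\<^sub>1, Y\<^sub>1, X\<^sub>2, Y\<^sub>2] ! i) {..<4}"
    and "\<And>X. X \<in> {X\<^sub>1, Y\<^sub>1, X\<^sub>2, Y\<^sub>2} \<Longrightarrow>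
           distr M lborel X = uniform_measure lborel {- D / 2 .. D / 2}"
  shows "((\<lambda>\<rho>. ergodic_secrecy_capacity M d \<eta> \<alpha> x\<^sub>0 X\<^sub>1 Y\<^sub>1 X\<^sub>2 Y\<^sub>2 \<rho> / log 2 \<rho>) \<longlongrightarrow> 0) at_top"
proof -
  interpret prob_space M by fact
  let ?I = "{- D / 2 .. D / 2}"
  let ?K = "1 / 2 * log 2 ((D\<^sup>2 + (D / 2)\<^sup>2 + d\<^sup>2) / d\<^sup>2)"
  let ?C = "ergodic_secrecy_capacity M d \<eta> \<alpha> x\<^sub>0 X\<^sub>1 Y\<^sub>1 X\<^sub>2 Y\<^sub>2"
  \<comment> \<open>Measurability of the coordinates is part of the definition of
    \<open>indep_vars\<close>.\<close>
  have rv: "random_variable borel ([X\<^sub>1, Y\<^sub>1, X\<^sub>2, Y\<^sub>2] ! i)" if "i < 4" for i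
    using assms(7) that unfolding indep_vars_def by auto
  have meas: "X\<^sub>1 \<in> borel_measurable M" "Y\<^sub>1 \<in> borel_measurable M"
      "X\<^sub>2 \<in> borel_measurable M" "Y\<^sub>2 \<in> borel_measurable M"
    using rv[of 0] rv[of 1] rv[of 2] rv[of 3] by (simp_all add: numeral_eq_Suc)
  have "AE \<omega> in M. X \<omega> \<in> ?I" if "X \<in> {X\<^sub>1, Y\<^sub>1, X\<^sub>2, Y\<^sub>2}" for X
    using that meas by (intro AE_in_uniform_distr[OF _ _ assms(8)]) auto
  then have "AE \<omega> in M. X\<^sub>1 \<omega> \<in> ?I" "AE \<omega> in M. Y\<^sub>1 \<omega> \<in> ?I"
      "AE \<omega> in M. X\<^sub>2 \<omega> \<in> ?I" "AE \<omega> in M. Y\<^sub>2 \<omega> \<in> ?I"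
    by blast+
  then have ae: "AE \<omega> in M. X\<^sub>1 \<omega> \<in> ?I \<and> Y\<^sub>1 \<omega> \<in> ?I \<and> X\<^sub>2 \<omega> \<in> ?I \<and> Y\<^sub>2 \<omega> \<in> ?I"
    by (simp only: AE_conj_iff)
  have bound: "\<bar>?C \<rho>\<bar> \<le> ?K" if "\<rho> > 0" for \<rho>
  proof -
    let ?f = "\<lambda>\<omega>. secrecy_rate d \<eta> \<alpha> x\<^sub>0 \<rho> (X\<^sub>1 \<omega>) (Y\<^sub>1 \<omega>) (X\<^sub>2 \<omega>) (Y\<^sub>2 \<omega>)"
    \<comment> \<open>Integrability, needed for monotonicity of the integral, rests on a bound that
      grows with \<rho>; the uniform bound \<open>?K\<close> enters only afterwards.\<close>
    have int: "integrable M ?f"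
      using assms(1,3,4,5) that meas by (rule integrable_secrecy_rate)
    have "\<bar>?C \<rho>\<bar> \<le> expectation (\<lambda>\<omega>. \<bar>?f \<omega>\<bar>)"
      unfolding ergodic_secrecy_capacity_def by (rule integral_abs_bound)
    also have "\<dots> \<le> expectation (\<lambda>_. ?K)"
    proof (rule integral_mono_AE)
      show "AE \<omega> in M. \<bar>?f \<omega>\<bar> \<le> ?K"
        using ae by eventually_elim (use assms(3,4) that in \<open>blast intro: abs_secrecy_rate_le\<close>)
    qed (use int in auto)
    also have "\<dots> = ?K"
      by (simp add: prob_space)
    finally show ?thesis .
  qed
  have lim: "((\<lambda>\<rho>. ?K / log 2 \<rho>) \<longlongrightarrow> 0) at_top"
    by (intro tendsto_divide_0[OF tendsto_const] filterlim_at_top_imp_at_infinity) real_asymp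
  show ?thesis
  proof (rule Lim_null_comparison[OF _ lim])
    show "\<forall>\<^sub>F \<rho> in at_top. norm (?C \<rho> / log 2 \<rho>) \<le> ?K / log 2 \<rho>"
      \<comment> \<open>For \<open>\<rho> > 1\<close> the logarithm is positive, so the absolute
        value in the denominator disappears.\<close>
      using eventually_gt_at_top[of 1]
    proof eventually_elim
      case (elim \<rho>)
      then have "0 < log 2 \<rho>" and "\<bar>?C \<rho>\<bar> \<le> ?K"
        using bound[of \<rho>] by auto
      then show ?case
        unfolding real_norm_def abs_divide by (simp only: abs_of_pos divide_right_mono less_imp_le)
    qed
  qed
qed

end
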